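(* Let $c\ge 1$ and $k_1,\ldots,k_c\ge 2$ be integers, and put $M=\sum_{i=1}^c(k_i-1)$. Let $R_{\mathrm{cop}}(k_1,\ldots,k_c)$ be the least positive integer $n$ such that for every coloring $\chi:\{1,\ldots,n\}\to\{1,\ldots,c\}$ there is a color $i$ for which $\chi^{-1}(i)$ contains $k_i$ pairwise coprime integers. Then \[ R_{\mathrm{cop}}(k_1,\ldots,k_c)=p_M, \] where $p_m$ denotes the $m$-th prime ($p_1=2$, $p_2=3,\ldots$).
   Context: A set of pairwise coprime integers means a set of distinct positive integers any two of which have greatest common divisor $1$ (the integer $1$ is coprime to every integer). Equivalently, such a set is a clique in the coprime graph $G_n$ on vertex set $\{1,\dots,n\}$, where distinct $a,b$ are adjacent iff $\gcd(a,b)=1$. *)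

theory Defs
  imports
    Main
    "HOL-Library.FuncSet"
    "HOL-Library.Infinite_Set"
    "HOL-Computational_Algebra.Primes"
begin

text \<open>1-based indexing: \<open>nth_prime 1 = 2\<close>, \<open>nth_prime 2 = 3\<close>. The value at 0 is junk.\<close>

definition nth_prime :: "nat \<Rightarrow> nat" where
  "nth_prime m = enumerate {p::nat. prime p} (m - 1)"

text \<open>Colours are \<open>1, \<dots>, c\<close>, and only the values \<open>k 1, \<dots>, k c\<close> are relevant.\<close>

definition coprime_ramsey :: "nat \<Rightarrow> (nat \<Rightarrow> nat) \<Rightarrow> nat \<Rightarrow> bool" where
  "coprime_ramsey c k n \<longleftrightarrow>
     (\<forall>\<chi> \<in> {1..n} \<rightarrow> {1..c}. \<exists>i\<in>{1..c}. \<exists>S \<subseteq> \<chi> -` {i} \<inter> {1..n}.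
        card S = k i \<and> pairwise coprime S)"

definition R_cop :: "nat \<Rightarrow> (nat \<Rightarrow> nat) \<Rightarrow> nat" where
  "R_cop c k = (LEAST n. n > 0 \<and> coprime_ramsey c k n)"

end

theory Submission
  imports Defs
begin

text \<open>
  Let \<open>T\<close> consist of \<open>1\<close> and the primes up to \<open>n\<close>. Then \<open>T\<close> is pairwise coprime, and sending
  \<open>1\<close> to \<open>1\<close> and every other number to one of its prime factors maps \<open>{1..n}\<close> to \<open>T\<close>
  injectively on every pairwise coprime set. Hence a colouring of \<open>{1..n}\<close> avoiding the cliques
  exists iff \<open>T\<close> can be split into classes of sizes at most \<open>k i - 1\<close>, that is, iff
  \<open>card T \<le> M\<close>. So the Ramsey property holds iff there are at least \<open>M\<close> primes up to \<open>n\<close>.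
\<close>

definition prime_slots :: "nat \<Rightarrow> nat set" where
  "prime_slots n = insert 1 {p. prime p \<and> p \<le> n}"

lemma finite_prime_slots [simp]: "finite (prime_slots n)"
  by (simp add: prime_slots_def)

lemma card_prime_slots: "card (prime_slots n) = Suc (card {p. prime p \<and> p \<le> n})"
  by (simp add: prime_slots_def)

lemma prime_slots_subset: "n \<ge> 1 \<Longrightarrow> prime_slots n \<subseteq> {1..n}"
  by (auto simp: prime_slots_def dest: prime_ge_1_nat)

lemma pairwise_coprime_prime_slots: "pairwise coprime (prime_slots n)"
  by (auto simp: pairwise_def prime_slots_def intro: primes_coprime)

text \<open>The clause on \<open>p = 1\<close> reserves the slot \<open>1\<close> for the number
  \<open>1\<close>; without it every number could choose \<open>1\<close>, and injectivity on
  coprime sets would be lost.\<close>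

lemma prime_slot_divisor_exists:
  fixes x n :: nat
  assumes "x \<in> {1..n}"
  shows "\<exists>p \<in> prime_slots n. p dvd x \<and> (p = 1 \<longrightarrow> x = 1)"
proof (cases "x = 1")
  case False
  then obtain p where "prime p" "p dvd x"
    using prime_factor_nat by blast
  moreover have "p \<le> n"
    using dvd_imp_le[OF \<open>p dvd x\<close>] assms by auto
  ultimately show ?thesis
    by (auto simp: prime_slots_def)
qed (auto simp: prime_slots_def)

text \<open>Give each \<open>i\<close> a block of \<open>d i\<close> places. \<open>T\<close>
  injects into the disjoint union \<open>?B\<close> of the blocks, and recording only the block of
  each element gives the map: its fibre over \<open>i\<close> still injects into block
  \<open>i\<close>.\<close>

lemma bounded_fibres_map_exists:
  fixes d :: "'b \<Rightarrow> nat"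
  assumes "finite T" "finite I" "card T \<le> (\<Sum>i\<in>I. d i)"
  shows "\<exists>g \<in> T \<rightarrow> I. \<forall>i\<in>I. card {x \<in> T. g x = i} \<le> d i"
proof -
  let ?B = "Sigma I (\<lambda>i. {..<d i})"
  have "card T \<le> card ?B"
    using assms by simp
  then obtain f where f: "f ` T \<subseteq> ?B" "inj_on f T"
    using card_le_inj[of T ?B] assms by auto
  have "card {x \<in> T. fst (f x) = i} \<le> d i" for i
  proof -
    have "card {x \<in> T. fst (f x) = i} \<le> card ({i} \<times> {..<d i})"
      by (rule card_inj_on_le[of f]) (use f in \<open>force intro: inj_on_subset\<close>)+
    then show ?thesis
      by (simp add: card_cartesian_product)
  qed
  moreover have "fst \<circ> f \<in> T \<rightarrow> I"
    using f(1) by force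
  ultimately show ?thesis
    by (intro bexI[of _ "fst \<circ> f"]) simp_all
qed

lemma coprime_ramseyI:
  assumes "n \<ge> 1" "(\<Sum>i=1..c. k i - 1) < card (prime_slots n)"
  shows "coprime_ramsey c k n"
  unfolding coprime_ramsey_def
proof
  fix \<chi> assume \<chi>: "\<chi> \<in> {1..n} \<rightarrow> {1..c}"
  let ?F = "\<lambda>i. {x \<in> prime_slots n. \<chi> x = i}"
  have "prime_slots n = (\<Union>i\<in>{1..c}. ?F i)"
    using \<chi> prime_slots_subset[OF assms(1)] by auto
  then have "card (prime_slots n) \<le> (\<Sum>i=1..c. card (?F i))"
    using card_UN_le[of "{1..c}" ?F] by simp
  \<comment> \<open>Pigeonhole: otherwise the colour classes would together hold at most the sum of
    the \<open>k i - 1\<close> slots.\<close>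
  then have "\<not> (\<forall>i\<in>{1..c}. card (?F i) \<le> k i - 1)"
    using assms(2) sum_mono[of "{1..c}" "\<lambda>i. card (?F i)" "\<lambda>i. k i - 1"] by force
  then obtain i where i: "i \<in> {1..c}" "k i \<le> card (?F i)"
    by force
  then obtain S where S: "S \<subseteq> ?F i" "card S = k i"
    using obtain_subset_with_card_n[OF i(2)] by blast
  have "pairwise coprime S"
    using pairwise_coprime_prime_slots by (rule pairwise_subset) (use S in auto)
  moreover have "S \<subseteq> \<chi> -` {i} \<inter> {1..n}"
    using S prime_slots_subset[OF assms(1)] by auto
  ultimately show "\<exists>i\<in>{1..c}. \<exists>S \<subseteq> \<chi> -` {i} \<inter> {1..n}. card S = k i \<and> pairwise coprime S"
    using i S by blast
qed

lemma coprime_ramseyD: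
  assumes k: "\<And>i. i \<in> {1..c} \<Longrightarrow> k i \<ge> 1" and ramsey: "coprime_ramsey c k n"
  shows "(\<Sum>i=1..c. k i - 1) < card (prime_slots n)"
proof (rule ccontr)
  assume "\<not> ?thesis"
  then obtain g where g: "g \<in> prime_slots n \<rightarrow> {1..c}"
    and fibre: "\<forall>i\<in>{1..c}. card {x \<in> prime_slots n. g x = i} \<le> k i - 1"
    using bounded_fibres_map_exists[of "prime_slots n" "{1..c}" "\<lambda>i. k i - 1"] by auto
  have "\<forall>x\<in>{1..n}. \<exists>p. p \<in> prime_slots n \<and> p dvd x \<and> (p = 1 \<longrightarrow> x = 1)"
    using prime_slot_divisor_exists by blast
  from bchoice[OF this] obtain h
    where h: "\<And>x. x \<in> {1..n} \<Longrightarrow> h x \<in> prime_slots n \<and> h x dvd x \<and> (h x = 1 \<longrightarrow> x = 1)"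
    by blast
  \<comment> \<open>The bad colouring: each number inherits the colour of its chosen slot.\<close>
  have "g \<circ> h \<in> {1..n} \<rightarrow> {1..c}"
    using g h by fastforce
  then obtain i S where i: "i \<in> {1..c}" and S: "S \<subseteq> (g \<circ> h) -` {i} \<inter> {1..n}"
    and card: "card S = k i" and coprime: "pairwise coprime S"
    using ramsey unfolding coprime_ramsey_def by blast
  have "inj_on h S"
  proof (rule inj_onI, rule ccontr)
    fix x y assume xy: "x \<in> S" "y \<in> S" "h x = h y" "x \<noteq> y"
    have "x \<in> {1..n}" "y \<in> {1..n}" "coprime x y"
      using xy S pairwiseD[OF coprime] by auto
    \<comment> \<open>The common value \<open>h x = h y\<close> divides both of the coprime numbers
      \<open>x\<close> and \<open>y\<close>, so it is \<open>1\<close>, which forces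
      \<open>x = 1 = y\<close>.\<close>
    with h[of x] h[of y] xy show False
      by (metis coprime_common_divisor_nat)
  qed
  moreover have "h ` S \<subseteq> {x \<in> prime_slots n. g x = i}"
    using S h by auto
  ultimately have "card S \<le> card {x \<in> prime_slots n. g x = i}"
    by (intro card_inj_on_le[of h]) auto
  \<comment> \<open>Subtraction is truncated, so \<open>k i \<le> k i - 1\<close> is absurd only
    because \<open>k i \<ge> 1\<close>.\<close>
  then show False
    using fibre i card k[OF i] by fastforce
qed

text \<open>Since \<open>enumerate\<close> is strictly increasing, the primes up to \<open>n\<close>
  form an initial segment of the enumeration. At \<open>m = 0\<close> truncation would make
  \<open>nth_prime 0\<close> equal to \<open>2\<close>, and the equivalence would fail for
  \<open>n < 2\<close>.\<close>

lemma card_primes_ge_iff: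
  assumes "m \<ge> 1"
  shows "m \<le> card {p. prime p \<and> p \<le> n} \<longleftrightarrow> nth_prime m \<le> n"
proof -
  let ?P = "{p::nat. prime p}"
  have inf: "infinite ?P"
    by (rule primes_infinite)
  have mono: "enumerate ?P i \<le> enumerate ?P j \<longleftrightarrow> i \<le> j" for i j
    using enumerate_mono_le_iff[OF inf] .
  have inj: "inj_on (enumerate ?P) A" for A
  proof (rule inj_onI)
    fix i j assume "enumerate ?P i = enumerate ?P j"
    with mono[of i j] mono[of j i] show "i = j"
      by simp
  qed
  show ?thesis
  proof
    assume "nth_prime m \<le> n"
    then have "enumerate ?P j \<le> n" if "j < m" for j
      using mono[of j "m - 1"] that by (auto simp: nth_prime_def)
    moreover have "prime (enumerate ?P j)" for j
      using enumerate_in_set[OF inf, of j] by simp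
    ultimately have "enumerate ?P ` {..<m} \<subseteq> {p. prime p \<and> p \<le> n}"
      by blast
    then show "m \<le> card {p. prime p \<and> p \<le> n}"
      using card_mono[of "{p. prime p \<and> p \<le> n}" "enumerate ?P ` {..<m}"]
      by (simp add: card_image[OF inj])
  next
    assume le: "m \<le> card {p. prime p \<and> p \<le> n}"
    show "nth_prime m \<le> n"
    proof (rule ccontr)
      assume less: "\<not> nth_prime m \<le> n"
      \<comment> \<open>Every prime up to \<open>n\<close> has index below \<open>m - 1\<close>,
        counting from 0, which leaves room for only \<open>m - 1\<close> of them.\<close>
      have "{p. prime p \<and> p \<le> n} \<subseteq> enumerate ?P ` {..<m - 1}"
      proof
        fix p assume p: "p \<in> {p. prime p \<and> p \<le> n}"
        then obtain j where j: "p = enumerate ?P j"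
          using enumerate_Ex[OF inf, of p] by auto
        then have "\<not> m - 1 \<le> j"
          using p less mono[of "m - 1" j] by (auto simp: nth_prime_def)
        with j show "p \<in> enumerate ?P ` {..<m - 1}"
          by auto
      qed
      from card_mono[OF _ this] le assms show False
        by (simp add: card_image[OF inj])
    qed
  qed
qed

theorem theorem3p2:
  fixes c :: nat and k :: "nat \<Rightarrow> nat"
  assumes "c \<ge> 1"
    and "\<And>i. i \<in> {1..c} \<Longrightarrow> k i \<ge> 2"
  shows "(\<exists>n>0. coprime_ramsey c k n) \<and> R_cop c k = nth_prime (\<Sum>i=1..c. k i - 1)"
proof -
  let ?M = "\<Sum>i=1..c. k i - 1"
  \<comment> \<open>Colour \<open>1\<close> alone contributes at least 1 to the sum, which keeps the
    index of \<open>nth_prime\<close> away from 0.\<close>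
  have "k 1 - 1 \<le> ?M"
    using assms(1) by (intro member_le_sum) auto
  then have M: "?M \<ge> 1"
    using assms(1) assms(2)[of 1] by simp
  have iff: "coprime_ramsey c k n \<longleftrightarrow> nth_prime ?M \<le> n" if "n > 0" for n
  proof -
    have "coprime_ramsey c k n \<longleftrightarrow> ?M < card (prime_slots n)"
      using coprime_ramseyI[of n k c] coprime_ramseyD[of c k n] assms(2) that by fastforce
    \<comment> \<open>The slot \<open>1\<close> absorbs the strict inequality: \<open>?M\<close> is
      below the number of slots iff it is at most the number of primes up to
      \<open>n\<close>.\<close>
    then show ?thesis
      using card_primes_ge_iff[OF M, of n] by (simp add: card_prime_slots less_Suc_eq_le)
  qed
  have "prime (nth_prime ?M)"
    using enumerate_in_set[OF primes_infinite] by (simp add: nth_prime_def)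
  then have pos: "nth_prime ?M > 0"
    by (rule prime_gt_0_nat)
  have "R_cop c k = nth_prime ?M"
    unfolding R_cop_def by (rule Least_equality) (use iff pos in auto)
  then show ?thesis
    using iff pos by blast
qed

end
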